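(* Let $R$ be an associative ring with unit and $q \in R$. Assume that $q\text{-char}(R) = p > 0$ and that $R$ is $q$-flat. Let $n,k,i,j \in \mathbb N$ with $i,j < p$. Then, in $R$, $$\binom{np+i}{kp+j}_q = \binom{n}{k}\binom{i}{j}_q,$$ where $\binom{n}{k}$ is (the image in $R$ of) the usual binomial coefficient. In particular, $\binom{np+i}{kp+j}_q = 0$ if $0 \le i < j < p$.
   Context: $\mathbb N$ includes $0$. For $m \in \mathbb N$, $(m)_q := \sum_{i=0}^{m-1} q^i \in R$. The $q$-characteristic $q\text{-char}(R)$ is the smallest positive integer $p$ such that $(p)_q = 0$ if it exists, and $0$ otherwise. $R$ is $q$-flat if for all $m \in \mathbb N$ and $a \in R$, $(m)_q a = 0$ if and only if $(m)_q = 0$ or $a = 0$. The $q$-binomial coefficients $\binom{n}{k}_q \in R$, $n,k\in\mathbb N$, are defined inductively by $\binom{0}{0}_q = 1$, $\binom{0}{k}_q = 0$ for $k \neq 0$, and $\binom{n}{k}_q = \binom{n-1}{k-1}_q + q^k \binom{n-1}{k}_q$ for $n \geq 1$ (with the convention that $\binom{n-1}{-1}_q = 0$); in particular $\binom{n}{k}_q = 0$ for $k > n$, and the same convention is used for usual binomial coefficients. *)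

theory Defs
  imports Main
begin

text \<open>
  The sort \<open>{ring, monoid_mult}\<close> is used for associative rings with unit: no commutativity, and,
  unlike \<open>ring_1\<close>, no requirement \<open>0 \<noteq> 1\<close>. The zero ring is thus included; its
  \<open>q\<close>-characteristic is \<open>1\<close>.
\<close>

definition qint :: "'a::{ring, monoid_mult} \<Rightarrow> nat \<Rightarrow> 'a" where
  "qint q m = (\<Sum>i<m. q ^ i)"

definition q_char :: "'a::{ring, monoid_mult} \<Rightarrow> nat" where
  "q_char q = (if \<exists>p>0. qint q p = 0 then LEAST p. p > 0 \<and> qint q p = 0 else 0)"

definition q_flat :: "'a::{ring, monoid_mult} \<Rightarrow> bool" where
  "q_flat q \<longleftrightarrow> (\<forall>m a. qint q m * a = 0 \<longleftrightarrow> qint q m = 0 \<or> a = 0)"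

text \<open>The \<open>case\<close> implements the convention that the coefficient with lower index \<open>-1\<close> vanishes.\<close>

primrec qbinom :: "'a::{ring, monoid_mult} \<Rightarrow> nat \<Rightarrow> nat \<Rightarrow> 'a" where
  "qbinom q 0 k = (if k = 0 then 1 else 0)"
| "qbinom q (Suc n) k =
     (case k of 0 \<Rightarrow> 0 | Suc k' \<Rightarrow> qbinom q n k') + q ^ k * qbinom q n k"

text \<open>
  The image of a natural number in the ring. The library's \<open>of_nat\<close> is only available for
  \<open>semiring_1\<close>, which excludes the zero ring.
\<close>

definition nat_image :: "nat \<Rightarrow> 'a::{ring, monoid_mult}" where
  "nat_image m = (\<Sum>i<m. 1)"

lemma nat_image_eq_of_nat: "nat_image m = (of_nat m :: 'a::ring_1)"
  by (simp add: nat_image_def)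

end

theory Submission
  imports Defs
begin

text \<open>
  This is the \<open>q\<close>-analogue of Lucas' theorem. Two facts about \<open>p = q_char q\<close> drive it.
  The first is \<open>q ^ p = 1\<close>, because \<open>q ^ p - 1\<close> is a multiple of \<open>qint q p = 0\<close>; so the
  weight \<open>q ^ K\<close> in Pascal's rule depends only on \<open>K\<close> modulo \<open>p\<close>. The second is that the
  \<open>p\<close>-th row of the \<open>q\<close>-Pascal triangle is \<open>1, 0, \<dots>, 0, 1\<close>: by the absorption identity
  \<open>qint_mult_qbinom\<close>, an inner entry \<open>qbinom q p j\<close> is annihilated by \<open>qint q j\<close>, which is nonzero
  by minimality of \<open>p\<close> and therefore cancels by \<open>q\<close>-flatness.

  Consequently the triangle is periodic up to scalars: below an entry at position \<open>(n p, k p)\<close>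
  a scaled copy of the first \<open>p\<close> rows unfolds, these copies stay disjoint, and at the row
  \<open>(n + 1) p\<close> each copy has collapsed to its two corner entries. Adjacent corners meet
  there and are added with weight \<open>1\<close>, so the scalars obey the ordinary Pascal rule and are
  ordinary binomial coefficients. Formally, this is an induction on the row number.

  The ring need not be commutative, but every element involved is a polynomial in \<open>q\<close> with
  integer coefficients, so any two of them commute.
\<close>

lemma nat_image_0 [simp]: "nat_image 0 = 0"
  by (simp add: nat_image_def)

lemma nat_image_1 [simp]: "nat_image (Suc 0) = 1"
  by (simp add: nat_image_def)

lemma nat_image_add: "nat_image (a + b) = nat_image a + nat_image b"
  by (induction b) (simp_all add: nat_image_def add.assoc)

lemma mult_nat_image_left_commute:
  "x * (nat_image m * y) = nat_image m * (x * y)" for x y :: "'a::{ring, monoid_mult}"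
  by (induction m) (simp_all add: nat_image_def algebra_simps)

lemma qint_0 [simp]: "qint q 0 = 0"
  by (simp add: qint_def)

lemma qint_Suc: "qint q (Suc m) = 1 + q * qint q m"
  by (simp add: qint_def sum.lessThan_Suc_shift sum_distrib_left del: sum.lessThan_Suc)

lemma qint_Suc_right: "qint q (Suc m) = qint q m + q ^ m"
  by (simp add: qint_def)

lemma qint_mult_power_commute: "qint q m * q ^ n = q ^ n * qint q m"
  by (simp add: qint_def sum_distrib_left sum_distrib_right flip: power_add)
    (simp add: add.commute)

lemma qint_mult_power_left_commute: "qint q m * (q ^ n * x) = q ^ n * (qint q m * x)"
  by (simp only: mult.assoc[symmetric] qint_mult_power_commute)

lemma power_eq_1_if_qint_eq_0:
  fixes q :: "'a::{ring, monoid_mult}"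
  assumes "qint q p = 0"
  shows "q ^ p = 1"
  using qint_Suc[of q p] qint_Suc_right[of q p] assms by simp

lemma qbinom_0_right [simp]: "qbinom q n 0 = 1"
  by (induction n) simp_all

lemma qbinom_Suc_Suc:
  "qbinom q (Suc n) (Suc k) = qbinom q n k + q ^ Suc k * qbinom q n (Suc k)"
  by simp

declare qbinom.simps(2) [simp del]

lemma qbinom_eq_0: "n < k \<Longrightarrow> qbinom q n k = 0"
proof (induction n arbitrary: k)
  case (Suc n)
  then show ?case by (cases k) (simp_all add: qbinom_Suc_Suc)
qed simp

lemma qbinom_self [simp]: "qbinom q n n = 1"
  by (induction n) (simp_all add: qbinom_Suc_Suc qbinom_eq_0)

text \<open>
  The absorption identity. Expanding \<open>qint q (Suc k)\<close> as \<open>1 + q * qint q k\<close> and \<open>qbinom\<close> by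
  Pascal's rule, the induction hypothesis turns both resulting products with a
  \<open>q\<close>-integer into multiples of one and the same \<open>q\<close>-integer, that of the row above, and these
  recombine by Pascal's rule.
\<close>

lemma qint_mult_qbinom:
  "qint q (Suc k) * qbinom q (Suc n) (Suc k) = qint q (Suc n) * qbinom q n k"
proof (induction n arbitrary: k)
  case 0
  then show ?case
    by (cases k) (simp_all add: qbinom_eq_0 qint_Suc qbinom_Suc_Suc)
next
  case (Suc n)
  have upper: "qint q (Suc k) * (q ^ Suc k * qbinom q (Suc n) (Suc k))
      = q ^ Suc k * (qint q (Suc n) * qbinom q n k)"
    by (simp only: qint_mult_power_left_commute Suc.IH)
  have "qint q (Suc k) * qbinom q (Suc (Suc n)) (Suc k)
      = qint q (Suc k) * qbinom q (Suc n) k + q ^ Suc k * (qint q (Suc n) * qbinom q n k)"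
    by (simp only: qbinom_Suc_Suc[of q "Suc n"] distrib_left upper)
  also have "q ^ Suc k * (qint q (Suc n) * qbinom q n k)
      = q * (qint q (Suc n) * (q ^ k * qbinom q n k))"
    by (simp only: power_Suc mult.assoc qint_mult_power_left_commute)
  also have "qint q (Suc k) * qbinom q (Suc n) k + \<dots> = qint q (Suc (Suc n)) * qbinom q (Suc n) k"
  proof (cases k)
    case 0
    then show ?thesis by (simp add: qint_Suc distrib_left)
  next
    case k: (Suc l)
    have "qint q (Suc k) * qbinom q (Suc n) k
        = qbinom q (Suc n) k + q * (qint q (Suc n) * qbinom q n l)"
      by (simp only: qint_Suc[of q k] distrib_right mult_1_left mult.assoc) (simp only: k Suc.IH)
    then have "qint q (Suc k) * qbinom q (Suc n) k + q * (qint q (Suc n) * (q ^ k * qbinom q n k))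
        = qbinom q (Suc n) k + q * (qint q (Suc n) * (qbinom q n l + q ^ k * qbinom q n k))"
      by (simp only: distrib_left add.assoc)
    also have "qbinom q n l + q ^ k * qbinom q n k = qbinom q (Suc n) k"
      by (simp only: k qbinom_Suc_Suc)
    finally show ?thesis
      by (simp only: qint_Suc[of q "Suc n"] distrib_right mult_1_left mult.assoc)
  qed
  finally show ?case .
qed

lemma qint_q_char:
  assumes "q_char q = p" "p > 0"
  shows "qint q p = 0"
proof -
  have ex: "\<exists>p>0. qint q p = 0"
    using assms by (auto simp: q_char_def split: if_splits)
  then have "p = (LEAST p. p > 0 \<and> qint q p = 0)"
    using assms by (simp add: q_char_def)
  with ex show ?thesis
    using LeastI_ex[of "\<lambda>p. p > 0 \<and> qint q p = 0"] by blast
qed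

lemma qint_neq_0_below_q_char:
  assumes "0 < m" "m < q_char q"
  shows "qint q m \<noteq> 0"
  using assms not_less_Least[of m "\<lambda>p. p > 0 \<and> qint q p = 0"]
  by (auto simp: q_char_def split: if_splits)

lemma qbinom_q_char_eq_0:
  assumes "q_char q = p" "q_flat q" "0 < j" "j < p"
  shows "qbinom q p j = 0"
proof -
  obtain l m where l: "j = Suc l" and m: "p = Suc m"
    using assms by (metis Suc_pred gr_zeroI less_trans)
  have "qint q j * qbinom q p j = 0"
    using qint_mult_qbinom[of q l m] qint_q_char[of q p] assms by (simp add: l m)
  then show ?thesis
    using assms qint_neq_0_below_q_char[of j q] by (auto simp: q_flat_def)
qed

text \<open>
  The periodic structure of the triangle follows from the shape of its \<open>p\<close>-th row and the
  periodicity of the weights \<open>q ^ K\<close>, by checking Pascal's rule at each entry: in the interior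
  of a copy it is the \<open>q\<close>-Pascal rule for \<open>i\<close> and \<open>j\<close>, and at the corners, where two copies
  meet, it is the ordinary Pascal rule for \<open>n\<close> and \<open>k\<close>.
\<close>

lemma qbinom_lucas:
  fixes q :: "'a::{ring, monoid_mult}"
  assumes qp: "q ^ p = 1"
    and row: "\<And>j. 0 < j \<Longrightarrow> j < p \<Longrightarrow> qbinom q p j = 0"
    and "i < p" "j < p"
  shows "qbinom q (n * p + i) (k * p + j) = nat_image (n choose k) * qbinom q i j"
  using \<open>i < p\<close> \<open>j < p\<close>
proof (induction "n * p + i" arbitrary: n i k j)
  case 0
  then show ?case by (cases k) auto
next
  case (Suc N)
  have period: "q ^ (m * p + l) = q ^ l" for m l
    using qp by (simp add: power_add power_mult mult.commute[of m])
  \<comment> \<open>Write the previous row as \<open>N = n' p + i'\<close>, stepping back over a multiple of \<open>p\<close> if \<open>i = 0\<close>.\<close>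
  define n' i' where "n' = N div p" and "i' = N mod p"
  have N: "N = n' * p + i'" and i': "i' < p"
    using Suc.prems by (simp_all add: n'_def i'_def)
  have IH: "qbinom q N (k * p + j) = nat_image (n' choose k) * qbinom q i' j" if "j < p" for k j
    using Suc.hyps(1)[OF N i' that] N by simp
  have cases: "n = n' \<and> i = Suc i' \<or> n = Suc n' \<and> i = 0 \<and> p = Suc i'"
  proof (cases "Suc i' < p")
    case True
    have "n * p + i = n' * p + Suc i'" using Suc.hyps(2) N by simp
    then have "(n * p + i) div p = (n' * p + Suc i') div p"
      and "(n * p + i) mod p = (n' * p + Suc i') mod p" by simp_all
    then show ?thesis using True Suc.prems by (simp del: add_Suc_right)
  next
    case False
    then have p: "p = Suc i'" using i' by simp
    then have "n * p + i = Suc n' * p" using Suc.hyps(2) N by simp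
    then have "(n * p + i) div p = (Suc n' * p) div p"
      and "(n * p + i) mod p = (Suc n' * p) mod p" by simp_all
    then have "n = Suc n' \<and> i = 0" using Suc.prems by (simp del: mult_Suc)
    then show ?thesis using p by simp
  qed
  show ?case
  proof (cases j)
    case j: (Suc l)
    \<comment> \<open>Both entries feeding this one lie in the same copy of the first \<open>p\<close> rows.\<close>
    have "qbinom q (Suc N) (k * p + j) = qbinom q N (k * p + l) + q ^ j * qbinom q N (k * p + j)"
      using qbinom_Suc_Suc[of q N "k * p + l"] period[of k j] by (simp add: j)
    also have "\<dots> = nat_image (n' choose k) * qbinom q (Suc i') j"
      using Suc.prems
      by (simp only: IH j Suc_lessD mult_nat_image_left_commute qbinom_Suc_Suc[of q i' l]
          distrib_left)
    finally have "qbinom q (Suc N) (k * p + j) = nat_image (n' choose k) * qbinom q (Suc i') j" .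
    then show ?thesis
      using cases row[of j] Suc.prems Suc.hyps(2) j by auto
  next
    case j: 0
    show ?thesis
    proof (cases k)
      case 0
      then show ?thesis using j by simp
    next
      case k: (Suc k')
      \<comment> \<open>Left border of a copy: the left parent is the entry \<open>p - 1\<close> of the neighbouring copy,
        which is nonzero only in the last row \<open>i' = p - 1\<close>.\<close>
      have "qbinom q (Suc N) (k * p)
          = qbinom q N (k' * p + (p - 1)) + q ^ (k * p) * qbinom q N (k * p)"
        using qbinom_Suc_Suc[of q N "k' * p + (p - 1)"] i' by (simp add: k add.commute)
      also have "\<dots> = nat_image (n' choose k') * qbinom q i' (p - 1) + nat_image (n' choose k)"
        using IH[of "p - 1" k'] IH[of 0 k] i' period[of k 0] by simp
      finally have corner: "qbinom q (Suc N) (k * p)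
          = nat_image (n' choose k') * qbinom q i' (p - 1) + nat_image (n' choose k)" .
      from cases show ?thesis
      proof
        assume "n = n' \<and> i = Suc i'"
        then show ?thesis
          using corner Suc.prems Suc.hyps(2) j qbinom_eq_0[of i' "p - 1" q] by simp
      next
        assume "n = Suc n' \<and> i = 0 \<and> p = Suc i'"
        then show ?thesis
          using corner Suc.hyps(2) j k by (simp add: nat_image_add)
      qed
    qed
  qed
qed

theorem proposition2p13:
  fixes q :: "'a::{ring, monoid_mult}" and p n k i j :: nat
  assumes "q_char q = p" and "p > 0"
    and "q_flat q"
    and "i < p" and "j < p"
  shows "qbinom q (n * p + i) (k * p + j) = nat_image (n choose k) * qbinom q i j
    \<and> (i < j \<longrightarrow> qbinom q (n * p + i) (k * p + j) = 0)"
proof -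
  have "qbinom q (n * p + i) (k * p + j) = nat_image (n choose k) * qbinom q i j"
    using assms
    by (intro qbinom_lucas power_eq_1_if_qint_eq_0 qint_q_char qbinom_q_char_eq_0)
  then show ?thesis by (simp add: qbinom_eq_0)
qed

end
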